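(* Let $n\ge 1$, let $W=(w_{ij})_{n\times n}$ be a row-stochastic matrix, let $\beta\in(0,1)$ and let $\alpha\in(0,1)$. Consider the best-response opinion dynamics $$x(k+1)=\beta x(k)+(1-\beta)\operatorname{BR}^\alpha(x(k);W),\qquad k\in\mathbb{N},$$ on the influence network $\mathcal{G}(W)$. Suppose that for each agent $i\in\{1,2,\dots,n\}$ there exists at least one index $j\in\{1,\dots,n\}$ such that $w_{ij}>0.5$. Then for any initial state $x(0)\in\mathbb{R}^n$, the solution $x(k)$ converges, as $k\to\infty$, to an equilibrium.
   Context: A matrix $W=(w_{ij})_{n\times n}$ is row-stochastic if all its entries are nonnegative and each row sums to $1$. $\mathcal{G}(W)$ is the weighted directed graph on the node set $\{1,\dots,n\}$ with a link from $i$ to $j$ (of weight $w_{ij}$) if and only if $w_{ij}>0$. $\mathbb{N}=\{0,1,2,\dots\}$. Social cost: for $x\in\mathbb{R}^n$, $z\in\mathbb{R}$ and $i\in\{1,\dots,n\}$, $u_i(z;x)=\sum_{j=1}^n w_{ij}|z-x_j|^\alpha$. Best-response operator: for $\alpha>0$, $\operatorname{BR}^\alpha(x;W)\in\mathbb{R}^n$ (also written $\operatorname{BR}^\alpha(x,W)$) has $i$-th component $\operatorname{BR}^\alpha_i(x;W)$ determined by: (1) $\operatorname{BR}^\alpha_i(x;W)\in\arg\min_{z\in\mathbb{R}}u_i(z;x)$; (2) $|\operatorname{BR}^\alpha_i(x;W)-x_i|\le|z^*-x_i|$ for all $z^*\in\arg\min_{z\in\mathbb{R}}u_i(z;x)$;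 (3) if two distinct minimizers $z_1,z_2$ of $u_i(\cdot;x)$ both attain the minimal distance to $x_i$ among all minimizers, then $\operatorname{BR}^\alpha_i(x;W)=\min\{z_1,z_2\}$. An equilibrium is a vector $x^*\in\mathbb{R}^n$ with $x^*=\beta x^*+(1-\beta)\operatorname{BR}^\alpha(x^*;W)$. *)

theory Defs
  imports "HOL-Analysis.Analysis"
begin

text \<open>
  Agents are the elements of a finite index type \<open>'n\<close>; \<open>W $ i $ j\<close> is the weight that agent \<open>i\<close>
  puts on agent \<open>j\<close>.  In the influence network of \<open>W\<close> there is a link from \<open>i\<close> to \<open>j\<close>, of that weight,
  iff \<open>W $ i $ j > 0\<close>, so the network is fully encoded by the matrix.
\<close>

definition row_stochastic :: "real ^ 'n ^ 'n \<Rightarrow> bool" where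
  "row_stochastic W \<longleftrightarrow> (\<forall>i j. 0 \<le> W $ i $ j) \<and> (\<forall>i. (\<Sum>j\<in>UNIV. W $ i $ j) = 1)"

text \<open>Since \<open>0 powr \<alpha> = 0\<close>, the terms with \<open>z = x $ j\<close> vanish, as they should for \<open>\<alpha> > 0\<close>.\<close>

definition social_cost :: "real \<Rightarrow> real ^ 'n ^ 'n \<Rightarrow> real ^ 'n \<Rightarrow> 'n \<Rightarrow> real \<Rightarrow> real" where
  "social_cost \<alpha> W x i z = (\<Sum>j\<in>UNIV. W $ i $ j * \<bar>z - x $ j\<bar> powr \<alpha>)"

definition minimizers :: "real \<Rightarrow> real ^ 'n ^ 'n \<Rightarrow> real ^ 'n \<Rightarrow> 'n \<Rightarrow> real set" where
  "minimizers \<alpha> W x i = {z. is_arg_min (social_cost \<alpha> W x i) (\<lambda>_. True) z}"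

definition nearest_minimizers :: "real \<Rightarrow> real ^ 'n ^ 'n \<Rightarrow> real ^ 'n \<Rightarrow> 'n \<Rightarrow> real set" where
  "nearest_minimizers \<alpha> W x i =
     {z \<in> minimizers \<alpha> W x i. \<forall>z' \<in> minimizers \<alpha> W x i. \<bar>z - x $ i\<bar> \<le> \<bar>z' - x $ i\<bar>}"

definition is_best_response :: "real \<Rightarrow> real ^ 'n ^ 'n \<Rightarrow> real ^ 'n \<Rightarrow> 'n \<Rightarrow> real \<Rightarrow> bool" where
  "is_best_response \<alpha> W x i b \<longleftrightarrow>
     b \<in> minimizers \<alpha> W x i \<and>
     (\<forall>z \<in> minimizers \<alpha> W x i. \<bar>b - x $ i\<bar> \<le> \<bar>z - x $ i\<bar>) \<and>
     (\<forall>z1 \<in> nearest_minimizers \<alpha> W x i. \<forall>z2 \<in> nearest_minimizers \<alpha> W x i.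
        z1 \<noteq> z2 \<longrightarrow> b = min z1 z2)"

text \<open>
  For row-stochastic \<open>W\<close> and \<open>\<alpha> > 0\<close> the cost is continuous and coercive in \<open>z\<close>, so its set of
  minimizers is nonempty and compact; at most two of them are nearest to \<open>x $ i\<close>.  Hence the
  description below is proper in that range of parameters.
\<close>

definition BR :: "real \<Rightarrow> real ^ 'n ^ 'n \<Rightarrow> real ^ 'n \<Rightarrow> real ^ 'n" where
  "BR \<alpha> W x = (\<chi> i. THE b. is_best_response \<alpha> W x i b)"

definition equilibrium :: "real \<Rightarrow> real \<Rightarrow> real ^ 'n ^ 'n \<Rightarrow> real ^ 'n \<Rightarrow> bool" where
  "equilibrium \<alpha> \<beta> W x \<longleftrightarrow> x = \<beta> *\<^sub>R x + (1 - \<beta>) *\<^sub>R BR \<alpha> W x"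

end

theory Submission
  imports Defs
begin

text \<open>
  An agent \<open>i\<close> who gives more than half of its weight to one agent \<open>d i\<close> has \<open>d i\<close>'s opinion as its
  unique best response: \<open>t \<mapsto> t powr \<alpha>\<close> is subadditive, so moving away from that opinion by a
  distance \<open>r\<close> costs more than \<open>r powr \<alpha> / 2\<close> on the heavy link and saves less than that on all other
  links together (\<open>BR_dominant\<close>).  The nonlinear dynamics is therefore the linear recursion
  \<open>x\<^sub>i(k+1) = \<beta> x\<^sub>i(k) + (1 - \<beta>) x\<^bsub>d i\<^esub>(k)\<close>, in which every agent follows exactly one agent.

  By finiteness the orbit \<open>i, d i, d (d i), \<dots>\<close> of every agent runs into a cycle.  Along a cycle the
  mean opinion is conserved, while each step takes from the sum of squares \<open>\<beta> (1 - \<beta>)\<close> times the sum of the squared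
  differences between neighbours.  Hence these differences tend to \<open>0\<close> and all opinions on the cycle
  tend to their conserved mean (\<open>convergent_on_cycle\<close>).  An agent who follows a converging opinion
  converges too (\<open>convergent_if_leader_convergent\<close>), so convergence spreads backwards from the cycle
  along the orbit.  Passing to the limit in the recursion shows that the limit is an equilibrium.
\<close>

section \<open>Best response to a dominant agent\<close>

lemma powr_subadditive:
  fixes a b \<alpha> :: real
  assumes "0 \<le> a" "0 \<le> b" "0 < \<alpha>" "\<alpha> \<le> 1"
  shows "(a + b) powr \<alpha> \<le> a powr \<alpha> + b powr \<alpha>"
proof (cases "a + b = 0")
  case True
  then show ?thesis using assms by simp
next
  case False
  then have pos: "0 < a + b" using assms by linarith
  \<comment> \<open>After normalising \<open>a + b\<close> to \<open>1\<close>, each share \<open>t \<in> [0, 1]\<close> satisfies \<open>t \<le> t powr \<alpha>\<close>.\<close>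
  have share: "t \<le> t powr \<alpha>" if "0 \<le> t" "t \<le> 1" for t :: real
    using powr_mono'[of \<alpha> 1 t] that assms by simp
  have "1 = a / (a + b) + b / (a + b)"
    using pos by (simp add: add_divide_distrib [symmetric])
  also have "\<dots> \<le> (a / (a + b)) powr \<alpha> + (b / (a + b)) powr \<alpha>"
    using pos assms by (intro add_mono share) auto
  also have "\<dots> = (a powr \<alpha> + b powr \<alpha>) / (a + b) powr \<alpha>"
    using pos assms by (simp add: powr_divide add_divide_distrib)
  finally show ?thesis
    using pos by (simp add: pos_le_divide_eq)
qed

lemma social_cost_dominant_less:
  fixes W :: "real ^ 'n ^ 'n" and x :: "real ^ 'n"
  assumes W: "row_stochastic W" and \<alpha>: "0 < \<alpha>" "\<alpha> \<le> 1"
    and dom: "W $ i $ d > 1 / 2" and z: "z \<noteq> x $ d"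
  shows "social_cost \<alpha> W x i (x $ d) < social_cost \<alpha> W x i z"
proof -
  let ?r = "\<bar>z - x $ d\<bar> powr \<alpha>"
  have r: "0 < ?r" using z by simp
  have "(\<Sum>j\<in>UNIV - {d}. W $ i $ j * (\<bar>x $ d - x $ j\<bar> powr \<alpha> - \<bar>z - x $ j\<bar> powr \<alpha>))
      \<le> (\<Sum>j\<in>UNIV - {d}. W $ i $ j * ?r)"
  proof (intro sum_mono mult_left_mono)
    fix j
    have "\<bar>x $ d - x $ j\<bar> powr \<alpha> \<le> (\<bar>z - x $ d\<bar> + \<bar>z - x $ j\<bar>) powr \<alpha>"
      using \<alpha> by (intro powr_mono2) auto
    also have "\<dots> \<le> ?r + \<bar>z - x $ j\<bar> powr \<alpha>"
      using \<alpha> by (intro powr_subadditive) auto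
    finally show "\<bar>x $ d - x $ j\<bar> powr \<alpha> - \<bar>z - x $ j\<bar> powr \<alpha> \<le> ?r" by simp
    show "0 \<le> W $ i $ j" using W by (simp add: row_stochastic_def)
  qed
  also have "\<dots> = (1 - W $ i $ d) * ?r"
    using W by (simp add: sum_distrib_right [symmetric] sum_diff1 row_stochastic_def)
  also have "\<dots> < W $ i $ d * ?r"
    using dom r by (intro mult_strict_right_mono) auto
  finally show ?thesis
    using \<alpha> unfolding social_cost_def sum.remove[OF finite UNIV_I, of _ d]
    by (simp add: right_diff_distrib sum_subtractf)
qed

lemma BR_dominant:
  fixes W :: "real ^ 'n ^ 'n" and x :: "real ^ 'n"
  assumes "row_stochastic W" "0 < \<alpha>" "\<alpha> \<le> 1" "W $ i $ d > 1 / 2"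
  shows "BR \<alpha> W x $ i = x $ d"
proof -
  note less = social_cost_dominant_less[where x = x, OF assms]
  have min: "minimizers \<alpha> W x i = {x $ d}"
  proof (intro equalityI subsetI)
    fix z assume "z \<in> minimizers \<alpha> W x i"
    then have "\<not> social_cost \<alpha> W x i (x $ d) < social_cost \<alpha> W x i z"
      by (simp add: minimizers_def is_arg_min_def)
    then show "z \<in> {x $ d}" using less by blast
  next
    fix z assume "z \<in> {x $ d}"
    then show "z \<in> minimizers \<alpha> W x i"
      using less by (auto simp: minimizers_def is_arg_min_def) (metis less_asym)
  qed
  then have "is_best_response \<alpha> W x i b \<longleftrightarrow> b = x $ d" for b
    by (auto simp: is_best_response_def nearest_minimizers_def)
  then have "is_best_response \<alpha> W x i = (\<lambda>b. b = x $ d)" by (rule ext)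
  then show ?thesis by (simp add: BR_def)
qed

section \<open>Averaging along a function\<close>

text \<open>
  Measured from the leader's limit, the follower's error is a geometrically damped sum of its own
  initial error and the leader's past errors; damping forgets all but the recent ones, which are
  small.
\<close>

lemma convergent_if_leader_convergent:
  fixes u v :: "nat \<Rightarrow> real"
  assumes \<beta>: "0 \<le> \<beta>" "\<beta> < 1"
    and rec: "\<And>k. u (Suc k) = \<beta> * u k + (1 - \<beta>) * v k"
    and v: "v \<longlonglongrightarrow> L"
  shows "u \<longlonglongrightarrow> L"
proof (rule LIMSEQ_I)
  fix r :: real assume r: "0 < r"
  obtain K where K: "\<And>k. k \<ge> K \<Longrightarrow> \<bar>v k - L\<bar> < r / 2"
    using LIMSEQ_D[OF v, of "r / 2"] r by auto
  have err: "\<bar>u (K + m) - L\<bar> \<le> \<beta> ^ m * \<bar>u K - L\<bar> + r / 2" for m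
  proof (induction m)
    case 0
    then show ?case using r by simp
  next
    case (Suc m)
    have "\<bar>u (K + Suc m) - L\<bar> = \<bar>\<beta> * (u (K + m) - L) + (1 - \<beta>) * (v (K + m) - L)\<bar>"
      by (simp add: rec algebra_simps)
    also have "\<dots> \<le> \<beta> * \<bar>u (K + m) - L\<bar> + (1 - \<beta>) * \<bar>v (K + m) - L\<bar>"
      using \<beta> by (intro order_trans[OF abs_triangle_ineq]) (simp add: abs_mult)
    also have "\<dots> \<le> \<beta> * (\<beta> ^ m * \<bar>u K - L\<bar> + r / 2) + (1 - \<beta>) * (r / 2)"
      using \<beta> Suc K[of "K + m"] by (intro add_mono mult_left_mono) auto
    also have "\<dots> = \<beta> ^ Suc m * \<bar>u K - L\<bar> + r / 2" by (simp add: field_simps)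
    finally show ?case .
  qed
  have "(\<lambda>m. \<beta> ^ m * \<bar>u K - L\<bar>) \<longlonglongrightarrow> 0 * \<bar>u K - L\<bar>"
    using \<beta> by (intro tendsto_intros LIMSEQ_power_zero) auto
  then obtain N where N: "\<And>m. m \<ge> N \<Longrightarrow> \<beta> ^ m * \<bar>u K - L\<bar> < r / 2"
    using order_tendstoD(2)[of "\<lambda>m. \<beta> ^ m * \<bar>u K - L\<bar>" 0 sequentially "r / 2"] r
    by (auto simp: eventually_sequentially)
  have "norm (u k - L) < r" if "k \<ge> K + N" for k
  proof -
    have "N \<le> k - K" "K + (k - K) = k" using that by auto
    then show ?thesis using err[of "k - K"] N[of "k - K"] by simp
  qed
  then show "\<exists>no. \<forall>k\<ge>no. norm (u k - L) < r" by blast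
qed

lemma sum_lessThan_cyclic_shift:
  fixes f :: "nat \<Rightarrow> 'a::ab_group_add"
  assumes "f p = f 0"
  shows "(\<Sum>m<p. f (Suc m)) = (\<Sum>m<p. f m)"
  using sum.lessThan_Suc_shift[of f p] assms by simp

text \<open>
  Here \<open>y m\<close> is the opinion of the \<open>m\<close>-th agent on a cycle of length \<open>p\<close>; the agents may repeat, so
  \<open>p\<close> need only be some period.
\<close>

lemma convergent_on_cycle:
  fixes y :: "nat \<Rightarrow> nat \<Rightarrow> real"
  assumes \<beta>: "0 < \<beta>" "\<beta> < 1" and p: "0 < p"
    and rec: "\<And>m k. y m (Suc k) = \<beta> * y m k + (1 - \<beta>) * y (Suc m) k"
    and cyc: "y p = y 0"
  shows "convergent (y 0)"
proof -
  define S where "S k = (\<Sum>m<p. (y m k)\<^sup>2)" for k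
  define D where "D k = (\<Sum>m<p. (y (Suc m) k - y m k)\<^sup>2)" for k
  have shift: "(\<Sum>m<p. y (Suc m) k) = (\<Sum>m<p. y m k)" for k
    using sum_lessThan_cyclic_shift[of "\<lambda>m. y m k" p] cyc by simp
  have shift2: "(\<Sum>m<p. (y (Suc m) k)\<^sup>2) = S k" for k
    unfolding S_def using sum_lessThan_cyclic_shift[of "\<lambda>m. (y m k)\<^sup>2" p] cyc by simp
  have energy: "S (Suc k) = S k - \<beta> * (1 - \<beta>) * D k" for k
  proof -
    \<comment> \<open>The variance identity for a two-point distribution with weights \<open>\<beta>\<close> and \<open>1 - \<beta>\<close>.\<close>
    have "(\<beta> * a + (1 - \<beta>) * b)\<^sup>2 = \<beta> * a\<^sup>2 + (1 - \<beta>) * b\<^sup>2 - \<beta> * (1 - \<beta>) * (b - a)\<^sup>2" for a b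
      by (simp add: power2_eq_square algebra_simps)
    then have "S (Suc k) = \<beta> * S k + (1 - \<beta>) * (\<Sum>m<p. (y (Suc m) k)\<^sup>2) - \<beta> * (1 - \<beta>) * D k"
      unfolding S_def D_def rec by (simp add: sum.distrib sum_subtractf sum_distrib_left)
    then show ?thesis by (simp add: shift2 algebra_simps)
  qed
  have D0: "0 \<le> D k" and S0: "0 \<le> S k" for k
    by (simp_all add: D_def S_def sum_nonneg)
  have "decseq S"
    using \<beta> D0 by (intro decseq_SucI) (simp add: energy)
  then obtain l where l: "S \<longlonglongrightarrow> l"
    using decseq_convergent S0 by blast
  have "(\<lambda>k. (S k - S (Suc k)) / (\<beta> * (1 - \<beta>))) \<longlonglongrightarrow> (l - l) / (\<beta> * (1 - \<beta>))"
    using \<beta> by (intro tendsto_intros l LIMSEQ_Suc) auto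
  moreover have "(S k - S (Suc k)) / (\<beta> * (1 - \<beta>)) = D k" for k
    using \<beta> by (simp add: energy)
  ultimately have D: "D \<longlonglongrightarrow> 0" by simp
  have step: "(\<lambda>k. y (Suc m) k - y m k) \<longlonglongrightarrow> 0" if "m < p" for m
  proof -
    have "(y (Suc m) k - y m k)\<^sup>2 \<le> D k" for k
      unfolding D_def using that by (intro member_le_sum) auto
    then have "(\<lambda>k. (y (Suc m) k - y m k)\<^sup>2) \<longlonglongrightarrow> 0"
      by (intro tendsto_sandwich[OF _ _ tendsto_const D]) auto
    then show ?thesis by simp
  qed
  have diff: "(\<lambda>k. y m k - y 0 k) \<longlonglongrightarrow> 0" if "m \<le> p" for m
    using that
  proof (induction m)
    case (Suc m)
    then have "(\<lambda>k. (y (Suc m) k - y m k) + (y m k - y 0 k)) \<longlonglongrightarrow> 0 + 0"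
      by (intro tendsto_add step) auto
    then show ?case by simp
  qed simp
  define A where "A = (\<Sum>m<p. y m 0)"
  have A: "(\<Sum>m<p. y m k) = A" for k
  proof (induction k)
    case (Suc k)
    have "(\<Sum>m<p. y m (Suc k)) = \<beta> * (\<Sum>m<p. y m k) + (1 - \<beta>) * (\<Sum>m<p. y (Suc m) k)"
      by (simp add: rec sum.distrib sum_distrib_left)
    then show ?case by (simp add: shift Suc algebra_simps)
  qed (simp add: A_def)
  have "(\<lambda>k. (A - (\<Sum>m<p. y m k - y 0 k)) / p) \<longlonglongrightarrow> (A - (\<Sum>m<p. 0)) / p"
    using p by (intro tendsto_intros diff) auto
  moreover have "(A - (\<Sum>m<p. y m k - y 0 k)) / p = y 0 k" for k
    using p by (simp add: sum_subtractf A)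
  ultimately have "y 0 \<longlonglongrightarrow> A / p" by simp
  then show ?thesis by (rule convergentI)
qed

lemma funpow_reaches_cycle:
  fixes d :: "'n::finite \<Rightarrow> 'n"
  obtains N p where "0 < p" "(d ^^ p) ((d ^^ N) i) = (d ^^ N) i"
proof -
  have "\<not> inj (\<lambda>m. (d ^^ m) i)"
    using finite_imageD[of "\<lambda>m. (d ^^ m) i" UNIV] by auto
  then obtain a b where "a < b" "(d ^^ a) i = (d ^^ b) i"
    by (auto simp: inj_def) (metis linorder_neqE_nat)
  then have "(d ^^ (b - a)) ((d ^^ a) i) = (d ^^ a) i"
    using \<open>a < b\<close> funpow_add[of "b - a" a d] by simp
  with \<open>a < b\<close> show ?thesis by (intro that[of "b - a" a]) auto
qed

lemma convergent_averaging_along_function: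
  fixes d :: "'n::finite \<Rightarrow> 'n" and x :: "nat \<Rightarrow> 'n \<Rightarrow> real"
  assumes \<beta>: "0 < \<beta>" "\<beta> < 1"
    and rec: "\<And>k i. x (Suc k) i = \<beta> * x k i + (1 - \<beta>) * x k (d i)"
  shows "convergent (\<lambda>k. x k i)"
proof -
  obtain N p where p: "0 < p" "(d ^^ p) ((d ^^ N) i) = (d ^^ N) i"
    by (rule funpow_reaches_cycle)
  have "convergent (\<lambda>k. x k ((d ^^ N) i))"
    using convergent_on_cycle[where y = "\<lambda>m k. x k ((d ^^ m) ((d ^^ N) i))", OF \<beta> p(1)] p(2)
    by (simp add: rec)
  then show ?thesis
  proof (induction N)
    case (Suc N)
    then obtain L where "(\<lambda>k. x k (d ((d ^^ N) i))) \<longlonglongrightarrow> L"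
      by (auto simp: convergent_def)
    then have "(\<lambda>k. x k ((d ^^ N) i)) \<longlonglongrightarrow> L"
      using \<beta> rec
      by (intro convergent_if_leader_convergent[where \<beta> = \<beta> and u = "\<lambda>k. x k ((d ^^ N) i)"
            and v = "\<lambda>k. x k (d ((d ^^ N) i))"]) auto
    then show ?case by (intro Suc.IH convergentI)
  qed simp
qed

section \<open>Convergence of the best-response dynamics\<close>

theorem theorem5:
  fixes W :: "real ^ 'n ^ 'n" and \<alpha> \<beta> :: real and x :: "nat \<Rightarrow> real ^ 'n"
  assumes "row_stochastic W"
    and "0 < \<beta>" "\<beta> < 1"
    and "0 < \<alpha>" "\<alpha> < 1"
    and "\<forall>i. \<exists>j. W $ i $ j > 0.5"
    and "\<forall>k. x (Suc k) = \<beta> *\<^sub>R x k + (1 - \<beta>) *\<^sub>R BR \<alpha> W (x k)"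
  shows "\<exists>x_lim. equilibrium \<alpha> \<beta> W x_lim \<and> x \<longlonglongrightarrow> x_lim"
proof -
  obtain d where "\<And>i. W $ i $ d i > 1 / 2"
    using assms(6) by (auto simp: choice_iff)
  then have BR: "BR \<alpha> W v $ i = v $ d i" for v i
    using assms(1,4,5) by (intro BR_dominant) auto
  have rec: "x (Suc k) $ i = \<beta> * x k $ i + (1 - \<beta>) * x k $ d i" for k i
    using assms(7) by (simp add: BR)
  have "convergent (\<lambda>k. x k $ i)" for i
    using convergent_averaging_along_function[where x = "\<lambda>k i. x k $ i", OF assms(2,3)] rec by blast
  then obtain L where L: "\<And>i. (\<lambda>k. x k $ i) \<longlonglongrightarrow> L i"
    unfolding convergent_def by metis
  have "L i = \<beta> * L i + (1 - \<beta>) * L (d i)" for i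
  proof (rule LIMSEQ_unique)
    show "(\<lambda>k. x (Suc k) $ i) \<longlonglongrightarrow> L i"
      using L by (rule LIMSEQ_Suc)
    show "(\<lambda>k. x (Suc k) $ i) \<longlonglongrightarrow> \<beta> * L i + (1 - \<beta>) * L (d i)"
      unfolding rec by (intro tendsto_intros L)
  qed
  then have "equilibrium \<alpha> \<beta> W (\<chi> i. L i)"
    by (simp add: equilibrium_def vec_eq_iff BR)
  moreover have "x \<longlonglongrightarrow> (\<chi> i. L i)"
    using L by (intro vec_tendstoI) simp
  ultimately show ?thesis by blast
qed

end
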